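(* Let $L\ge1$ be an integer, $\sigma^2>0$, $m>0.5$ and $m_I>0$. Let $g_d,g_1,\dots,g_L$ be mutually independent random variables such that $g_d$ is a unit-mean Nakagami power random variable with parameter $m$ and $g_1,\dots,g_L$ are identically distributed unit-mean Nakagami power random variables with parameter $m_I$. Then the error vector magnitude in the presence of interference and noise, $\mathrm{EVM}=\mathbb{E}\left[\sqrt{\left(\sum_{l=1}^L g_l+\sigma^2\right)/g_d}\right]$, equals $$\frac{\left(\sigma^2m_I\right)^{m_IL}\,U\!\left(m_IL,\ \tfrac32+m_IL,\ \sigma^2m_I\right)\Gamma(m-0.5)}{(m\sigma^2)^{-0.5}\,\Gamma(m)}.$$
   Context: Unit-mean Nakagami power random variable with parameter $m>0$: a Gamma random variable with shape $m$ and scale $1/m$, i.e. density $\frac{m^m x^{m-1}e^{-mx}}{\Gamma(m)}$, $x>0$. EVM: a desired signal with fading power $g_d$ is received together with $L$ interferers with fading powers $g_1,\dots,g_L$ and zero-mean complex Gaussian noise of variance $\sigma^2$; with unit symbol energy, the error vector magnitude is $\mathrm{EVM}=\mathbb{E}\left[\sqrt{\left(\sum_{l=1}^L g_l+\sigma^2\right)/g_d}\right]$. $U(a,b,z)=\frac{1}{\Gamma(a)}\int_0^\infty e^{-zt}t^{a-1}(1+t)^{b-a-1}\,dt$ ($a,z>0$) is the Tricomi confluent hypergeometric function. *)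

theory Defs
  imports "HOL-Probability.Probability"
begin

definition nakagami_power_density :: "real \<Rightarrow> real \<Rightarrow> real" where
  "nakagami_power_density m x =
     (if x > 0 then m powr m * x powr (m - 1) * exp (- m * x) / Gamma m else 0)"

definition nakagami_power :: "'a measure \<Rightarrow> real \<Rightarrow> ('a \<Rightarrow> real) \<Rightarrow> bool" where
  "nakagami_power M m X \<longleftrightarrow>
     distributed M lborel X (\<lambda>x. ennreal (nakagami_power_density m x))"

text \<open>Meaningful for \<open>a > 0\<close> and \<open>z > 0\<close>, where the integral converges.\<close>

definition tricomi_U :: "real \<Rightarrow> real \<Rightarrow> real \<Rightarrow> real" where
  "tricomi_U a b z =
     1 / Gamma a * (LBINT t:{0<..}. exp (- z * t) * t powr (a - 1) * (1 + t) powr (b - a - 1))"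

text \<open>The argument \<open>v\<close> is the noise variance; the interferers are \<open>g 1, \<dots>, g L\<close>.\<close>

definition EVM ::
    "'a measure \<Rightarrow> nat \<Rightarrow> real \<Rightarrow> ('a \<Rightarrow> real) \<Rightarrow> (nat \<Rightarrow> 'a \<Rightarrow> real) \<Rightarrow> real" where
  "EVM M L v gd g = (LINT \<omega>|M. sqrt (((\<Sum>l = 1..L. g l \<omega>) + v) / gd \<omega>))"

end

theory Submission
  imports Defs
begin

text \<open>
  The sum of the interferers is Gamma distributed with shape \<open>a = m\<^sub>I L\<close> and rate \<open>m\<^sub>I\<close>, so by
  independence the EVM is the product of the moment of order \<open>- 1 / 2\<close> of a Gamma variable and of
  the integral of \<open>sqrt (x + \<sigma>\<^sup>2)\<close> against a Gamma density. The substitution \<open>x = \<sigma>\<^sup>2 t\<close> turns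
  the latter into the integral that defines \<open>U(a, a + 3 / 2, \<sigma>\<^sup>2 m\<^sub>I)\<close>.
\<close>

text \<open>Shape \<open>k\<close> and rate \<open>l\<close> are kept apart because the Nakagami
  family, where both agree, is not closed under sums: adding interferers changes the shape but not
  the rate.\<close>

definition gamma_density :: "real \<Rightarrow> real \<Rightarrow> real \<Rightarrow> real" where
  "gamma_density k l x =
     (if x > 0 then l powr k * x powr (k - 1) * exp (- l * x) / Gamma k else 0)"

lemma nakagami_power_density_conv_gamma: "nakagami_power_density m = gamma_density m m"
  by (simp add: fun_eq_iff nakagami_power_density_def gamma_density_def)

lemma gamma_density_measurable [measurable]: "gamma_density k l \<in> borel_measurable borel"
  unfolding gamma_density_def by measurable

lemma gamma_density_nonneg: "k > 0 \<Longrightarrow> gamma_density k l x \<ge> 0"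
  by (simp add: gamma_density_def Gamma_real_pos less_imp_le)

text \<open>Substitute \<open>l * x\<close> for the variable in the Euler integral of
  \<open>Gamma (k + p)\<close>. Working with nonnegative integrals yields integrability together
  with the value. The exponent \<open>p = - 1 / 2\<close> serves the desired signal;
  \<open>p = 0\<close> and \<open>p = 1\<close> serve a domination argument.\<close>

lemma has_bochner_integral_gamma_density_powr:
  assumes k: "k > 0" and l: "l > 0" and kp: "k + p > 0"
  shows "has_bochner_integral lborel (\<lambda>x. gamma_density k l x * x powr p)
           (Gamma (k + p) / (Gamma k * l powr p))"
proof (rule has_bochner_integral_nn_integral)
  let ?I = "\<integral>\<^sup>+x. ennreal (gamma_density k l x * x powr p) \<partial>lborel"
  define c where "c = Gamma k * l powr p"
  have c: "c > 0"
    using k l by (simp add: c_def Gamma_real_pos)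
  \<comment> \<open>The left side is the Euler integrand after the substitution; the summand
    \<open>0 +\<close> is the offset of the affine substitution rule. Excluding one point costs only
    a null set.\<close>
  have pointwise: "ennreal l * ennreal (indicator {0..} (0 + l * x) * (0 + l * x) powr (k + p - 1) / exp (0 + l * x))
      = ennreal c * ennreal (gamma_density k l x * x powr p)" if "x \<noteq> 0" for x
  proof (cases "x > 0")
    case True
    have e: "l * (l * x) powr (k + p - 1) = l powr p * (l powr k * x powr (k - 1) * x powr p)"
      using True l by (simp add: powr_mult powr_add powr_diff)
    have "l * ((l * x) powr (k + p - 1) / exp (l * x)) =
        c * (gamma_density k l x * x powr p)"
      using True l e Gamma_real_pos[OF k, THEN less_imp_neq]
      by (simp add: gamma_density_def c_def exp_minus field_simps)
    then show ?thesis
      using True l c by (simp add: ennreal_mult'[symmetric])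
  next
    case False
    with that l show ?thesis
      by (simp add: gamma_density_def indicator_def zero_le_mult_iff)
  qed
  have "ennreal (Gamma (k + p)) =
      ennreal l * (\<integral>\<^sup>+x. ennreal (indicator {0..} (0 + l * x) * (0 + l * x) powr (k + p - 1) / exp (0 + l * x)) \<partial>lborel)"
    using l unfolding Gamma_conv_nn_integral_real[OF kp]
    by (subst nn_integral_real_affine[where c = l and t = 0]) auto
  also have "\<dots> = (\<integral>\<^sup>+x. ennreal l * ennreal (indicator {0..} (0 + l * x) * (0 + l * x) powr (k + p - 1) / exp (0 + l * x)) \<partial>lborel)"
    by (rule nn_integral_cmult[symmetric]) measurable
  also have "\<dots> = (\<integral>\<^sup>+x. ennreal c * ennreal (gamma_density k l x * x powr p) \<partial>lborel)"
    by (intro nn_integral_cong_AE eventually_mono[OF AE_lborel_singleton[of 0]] pointwise)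
  also have "\<dots> = ennreal c * ?I"
    by (rule nn_integral_cmult) measurable
  finally have *: "ennreal (Gamma (k + p)) = ennreal c * ?I" .
  \<comment> \<open>Multiplying by \<open>1 / c\<close> isolates \<open>?I\<close> without knowing
    beforehand that it is finite.\<close>
  have "?I = ennreal (1 / c) * (ennreal c * ?I)"
    using c by (simp add: mult.assoc[symmetric] ennreal_mult'[symmetric])
  also have "\<dots> = ennreal (Gamma (k + p) / c)"
    unfolding *[symmetric] using c by (simp add: ennreal_mult'[symmetric])
  finally show "?I = ennreal (Gamma (k + p) / (Gamma k * l powr p))"
    by (simp add: c_def)
  show "0 \<le> Gamma (k + p) / (Gamma k * l powr p)"
    using k kp by (simp add: Gamma_real_pos less_imp_le)
qed (use k in \<open>auto simp: gamma_density_nonneg\<close>)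

text \<open>Because the rates agree, the two exponentials merge into \<open>exp (- l * x)\<close>,
  which no longer involves \<open>y\<close>. For \<open>x > 0\<close> the substitution
  \<open>y = x * t\<close> leaves the integral of \<open>Beta b a\<close>, whose Gamma factors
  cancel those of the two densities.\<close>

lemma convolution_gamma_density:
  assumes a: "a > 0" and b: "b > 0" and l: "l > 0"
  shows "(\<integral>\<^sup>+y. ennreal (gamma_density a l (x - y)) * ennreal (gamma_density b l y) \<partial>lborel) =
    ennreal (gamma_density (a + b) l x)"
proof (cases "x > 0")
  case False
  \<comment> \<open>For \<open>x \<le> 0\<close> the arguments \<open>x - y\<close> and
    \<open>y\<close> are never both positive.\<close>
  then have "(\<integral>\<^sup>+y. ennreal (gamma_density a l (x - y)) * ennreal (gamma_density b l y) \<partial>lborel) =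
      (\<integral>\<^sup>+y. 0 \<partial>(lborel :: real measure))"
    by (intro nn_integral_cong) (simp add: gamma_density_def)
  with False show ?thesis
    by (simp add: gamma_density_def)
next
  case True
  \<comment> \<open>\<open>C\<close> collects all factors that do not depend on
    \<open>t\<close>.\<close>
  define C where "C = l powr (a + b) * x powr (a + b - 1) * exp (- l * x) / (Gamma a * Gamma b)"
  have G: "Gamma a > 0" "Gamma b > 0" "Gamma (a + b) > 0"
    using a b by (auto simp: Gamma_real_pos)
  have C: "C \<ge> 0"
    using G by (simp add: C_def)
  have pointwise: "ennreal x * (ennreal (gamma_density a l (x - (0 + x * t))) * ennreal (gamma_density b l (0 + x * t)))
      = ennreal C * ennreal (indicator {0..1} t * (t powr (b - 1) * (1 - t) powr (a - 1)))"
    if "t \<noteq> 0" "t \<noteq> 1" for t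
  proof (cases "0 < t \<and> t < 1")
    case t: True
    have 1: "x - x * t = x * (1 - t)"
      by (simp add: algebra_simps)
    have 2: "exp (- l * (x * (1 - t))) * exp (- l * (x * t)) = exp (- l * x)"
      by (simp add: exp_add[symmetric] algebra_simps)
    have 3: "x * ((x * (1 - t)) powr (a - 1) * (x * t) powr (b - 1)) =
        x powr (a + b - 1) * ((1 - t) powr (a - 1) * t powr (b - 1))"
      using t True by (simp add: powr_mult powr_add powr_diff mult_ac)
    have "x * (gamma_density a l (x * (1 - t)) * gamma_density b l (x * t)) =
        l powr a * l powr b * (x * ((x * (1 - t)) powr (a - 1) * (x * t) powr (b - 1)))
          * (exp (- l * (x * (1 - t))) * exp (- l * (x * t))) / (Gamma a * Gamma b)"
      using t True by (simp add: gamma_density_def)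
    also have "\<dots> = C * (t powr (b - 1) * (1 - t) powr (a - 1))"
      unfolding 2 3 by (simp add: C_def powr_add)
    finally show ?thesis
      using t True C a b 1
      by (simp add: ennreal_mult'[symmetric] gamma_density_nonneg)
  next
    case False
    then have "t < 0 \<or> t > 1"
      using that by auto
    then show ?thesis
      using True by (auto simp: gamma_density_def indicator_def zero_less_mult_iff)
  qed
  have "(\<integral>\<^sup>+y. ennreal (gamma_density a l (x - y)) * ennreal (gamma_density b l y) \<partial>lborel) =
      ennreal x * (\<integral>\<^sup>+t. ennreal (gamma_density a l (x - (0 + x * t))) * ennreal (gamma_density b l (0 + x * t)) \<partial>lborel)"
    using True by (subst nn_integral_real_affine[where c = x and t = 0]) auto
  also have "\<dots> = (\<integral>\<^sup>+t. ennreal x * (ennreal (gamma_density a l (x - (0 + x * t))) * ennreal (gamma_density b l (0 + x * t))) \<partial>lborel)"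
    by (rule nn_integral_cmult[symmetric]) measurable
  also have "\<dots> = (\<integral>\<^sup>+t. ennreal C * ennreal (indicator {0..1} t * (t powr (b - 1) * (1 - t) powr (a - 1))) \<partial>lborel)"
    by (rule nn_integral_cong_AE)
      (use AE_lborel_singleton[of 0] AE_lborel_singleton[of 1] in eventually_elim, rule pointwise)
  also have "\<dots> = ennreal C * (\<integral>\<^sup>+t. ennreal (indicator {0..1} t * (t powr (b - 1) * (1 - t) powr (a - 1))) \<partial>lborel)"
    by (rule nn_integral_cmult) measurable
  also have "(\<integral>\<^sup>+t. ennreal (indicator {0..1} t * (t powr (b - 1) * (1 - t) powr (a - 1))) \<partial>lborel) = ennreal (Beta b a)"
    using nn_integral_has_integral_lebesgue[OF _ has_integral_Beta_real[OF b a]] by simp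
  also have "ennreal C * ennreal (Beta b a) = ennreal (gamma_density (a + b) l x)"
    using True C G by (simp add: ennreal_mult'[symmetric] Beta_def C_def gamma_density_def add.commute)
  finally show ?thesis .
qed

text \<open>Induction with one convolution per step. It starts at singletons, since the empty sum is
  the constant 0 and has no density.\<close>

lemma (in prob_space) sum_indep_gamma:
  assumes "finite I" "I \<noteq> {}" and l: "l > 0"
    and "\<And>i. i \<in> I \<Longrightarrow> k i > 0"
    and "\<And>i. i \<in> I \<Longrightarrow> distributed M lborel (X i) (gamma_density (k i) l)"
    and "indep_vars (\<lambda>_. borel) X I"
  shows "distributed M lborel (\<lambda>x. \<Sum>i\<in>I. X i x) (gamma_density (\<Sum>i\<in>I. k i) l)"
  using assms(1,2,4-)
proof (induction rule: finite_ne_induct)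
  case (singleton i)
  then show ?case by simp
next
  case (insert i I)
  have pos: "(\<Sum>i\<in>I. k i) > 0"
    using insert by (intro sum_pos) auto
  have "distributed M lborel (\<lambda>x. X i x + (\<Sum>i\<in>I. X i x))
      (\<lambda>x. \<integral>\<^sup>+y. ennreal (gamma_density (k i) l (x - y)) * ennreal (gamma_density (\<Sum>i\<in>I. k i) l y) \<partial>lborel)"
  proof (rule distributed_convolution)
    show "indep_var borel (X i) borel (\<lambda>x. \<Sum>i\<in>I. X i x)"
      using insert by (intro indep_vars_sum) auto
    show "distributed M lborel (X i) (gamma_density (k i) l)"
      using insert by simp
    show "distributed M lborel (\<lambda>x. \<Sum>i\<in>I. X i x) (gamma_density (\<Sum>i\<in>I. k i) l)"
      using insert by (intro insert.IH) (auto intro: indep_vars_subset)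
  qed
  then show ?case
    using insert l pos by (simp add: convolution_gamma_density)
qed

text \<open>After \<open>x = v * t\<close> the root becomes \<open>sqrt v * sqrt (1 + t)\<close>, so
  the Tricomi exponent \<open>b - a - 1\<close> must be \<open>1 / 2\<close>; this gives
  \<open>b = 3 / 2 + a\<close>. The substitution is valid for Bochner integrals regardless of
  convergence, so integrability is left to the main proof.\<close>

lemma gamma_density_integral_sqrt:
  assumes a: "a > 0" and l: "l > 0" and v: "v > 0"
  shows "(\<integral>x. gamma_density a l x * sqrt (x + v) \<partial>lborel) =
    sqrt v * (v * l) powr a * tricomi_U a (3 / 2 + a) (v * l)"
proof -
  have "(\<integral>x. gamma_density a l x * sqrt (x + v) \<partial>lborel) =
      v * (\<integral>t. gamma_density a l (0 + v * t) * sqrt (0 + v * t + v) \<partial>lborel)"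
    using v lborel_integral_real_affine[of v "\<lambda>x. gamma_density a l x * sqrt (x + v)" 0] by simp
  also have "\<dots> = (\<integral>t. v * (gamma_density a l (0 + v * t) * sqrt (0 + v * t + v)) \<partial>lborel)"
    by simp
  also have "\<dots> = (\<integral>t. sqrt v * (v * l) powr a / Gamma a * (indicator {0<..} t *\<^sub>R
      (exp (- (v * l) * t) * t powr (a - 1) * (1 + t) powr (3 / 2 + a - a - 1))) \<partial>lborel)"
  proof (rule Bochner_Integration.integral_cong[OF refl])
    fix t :: real
    show "v * (gamma_density a l (0 + v * t) * sqrt (0 + v * t + v)) =
      sqrt v * (v * l) powr a / Gamma a * (indicator {0<..} t *\<^sub>R
      (exp (- (v * l) * t) * t powr (a - 1) * (1 + t) powr (3 / 2 + a - a - 1)))"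
    proof (cases "t > 0")
      case True
      have 1: "sqrt (v * t + v) = sqrt v * sqrt (1 + t)"
        by (simp add: real_sqrt_mult[symmetric] algebra_simps)
      have 2: "(1 + t) powr (3 / 2 + a - a - 1) = sqrt (1 + t)"
        using True by (simp add: powr_half_sqrt)
      have 3: "v * (l powr a * (v * t) powr (a - 1)) = (v * l) powr a * t powr (a - 1)"
        using True v l by (simp add: powr_mult powr_diff)
      have "v * (gamma_density a l (v * t) * sqrt (v * t + v)) =
          v * (l powr a * (v * t) powr (a - 1)) * exp (- l * (v * t)) * (sqrt v * sqrt (1 + t)) / Gamma a"
        using True v by (simp add: gamma_density_def 1)
      then show ?thesis
        using True unfolding 2 3 by (simp add: mult_ac)
    next
      case False
      then show ?thesis
        using v by (simp add: gamma_density_def zero_less_mult_iff)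
    qed
  qed
  finally show ?thesis
    by (simp add: tricomi_U_def set_lebesgue_integral_def)
qed

theorem corollary6:
  fixes M :: "'a measure"
    and L :: nat
    and \<sigma> m m\<^sub>I :: real
    and gd :: "'a \<Rightarrow> real"
    and g :: "nat \<Rightarrow> 'a \<Rightarrow> real"
  assumes "prob_space M"
    and "L \<ge> 1"
    and "\<sigma>\<^sup>2 > 0"
    and "m > 1 / 2"
    and "m\<^sub>I > 0"
    and "prob_space.indep_vars M (\<lambda>_. borel) (\<lambda>l. if l = 0 then gd else g l) {0..L}"
    and "nakagami_power M m gd"
    and "\<And>l. l \<in> {1..L} \<Longrightarrow> nakagami_power M m\<^sub>I (g l)"
  shows "EVM M L (\<sigma>\<^sup>2) gd g =
    ((\<sigma>\<^sup>2 * m\<^sub>I) powr (m\<^sub>I * real L)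
      * tricomi_U (m\<^sub>I * real L) (3 / 2 + m\<^sub>I * real L) (\<sigma>\<^sup>2 * m\<^sub>I)
      * Gamma (m - 1 / 2))
    / ((m * \<sigma>\<^sup>2) powr (- 1 / 2) * Gamma m)"
proof -
  interpret prob_space M by fact
  define v where "v = \<sigma>\<^sup>2"
  define a where "a = m\<^sub>I * real L"
  let ?S = "\<lambda>\<omega>. \<Sum>l = 1..L. g l \<omega>"
  have v: "v > 0" and a: "a > 0" and m: "m > 0"
    using assms by (auto simp: v_def a_def)
  have gd: "distributed M lborel gd (gamma_density m m)"
    using assms(7) by (simp add: nakagami_power_def nakagami_power_density_conv_gamma)
  have g: "distributed M lborel (g l) (gamma_density m\<^sub>I m\<^sub>I)" if "l \<in> {1..L}" for l
    using assms(8)[OF that] by (simp add: nakagami_power_def nakagami_power_density_conv_gamma)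
  have indep_g: "indep_vars (\<lambda>_. borel) g {1..L}"
  proof -
    have "indep_vars (\<lambda>_. borel) (\<lambda>l. if l = 0 then gd else g l) {1..L}"
      by (rule indep_vars_subset[OF assms(6)]) auto
    then show ?thesis
      by (rule indep_vars_cong[THEN iffD1, rotated -1]) auto
  qed
  have S: "distributed M lborel ?S (gamma_density a m\<^sub>I)"
    using sum_indep_gamma[of "{1..L}" m\<^sub>I "\<lambda>_. m\<^sub>I" g] assms(2,5) g indep_g
    by (simp add: a_def mult.commute)
  \<comment> \<open>Index 0 of the joint family stands for \<open>gd\<close>. The conditional stays
    unreduced so that the statement is an instance of \<open>indep_vars_sum\<close>.\<close>
  have "indep_var borel (if 0 = (0::nat) then gd else g 0) borel
      (\<lambda>\<omega>. \<Sum>l = 1..L. (if l = 0 then gd else g l) \<omega>)"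
  proof (rule indep_vars_sum[where X = "\<lambda>l. if l = 0 then gd else g l"])
    have "insert 0 {1..L} = {0..L}"
      by auto
    then show "indep_vars (\<lambda>_. borel) (\<lambda>l. if l = 0 then gd else g l) (insert 0 {1..L})"
      using assms(6) by simp
  qed auto
  also have "(\<lambda>\<omega>. \<Sum>l = 1..L. (if l = 0 then gd else g l) \<omega>) = ?S"
    by (intro ext sum.cong) auto
  finally have indep_gd_S: "indep_var borel gd borel ?S"
    by simp
  have indep: "indep_var borel (\<lambda>\<omega>. 1 / sqrt (gd \<omega>)) borel (\<lambda>\<omega>. sqrt (?S \<omega> + v))"
  proof -
    have "indep_var borel ((\<lambda>x. 1 / sqrt x) \<circ> gd) borel ((\<lambda>x. sqrt (x + v)) \<circ> ?S)"
      by (intro indep_var_compose[OF indep_gd_S]) auto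
    then show ?thesis
      by (simp add: o_def)
  qed

  \<comment> \<open>Off the positive axis \<open>x powr (- 1 / 2)\<close> and
    \<open>1 / sqrt x\<close> may differ, but there the density vanishes.\<close>
  have "gamma_density m m x * x powr (- 1 / 2) = gamma_density m m x * (1 / sqrt x)" for x
    by (cases "x > 0") (auto simp: gamma_density_def powr_minus_divide powr_half_sqrt)
  \<comment> \<open>Here \<open>m > 1 / 2\<close> enters: it makes the shifted shape
    \<open>m - 1 / 2\<close> positive.\<close>
  then have moment: "has_bochner_integral lborel (\<lambda>x. gamma_density m m x * (1 / sqrt x))
      (Gamma (m - 1 / 2) / (Gamma m * m powr (- 1 / 2)))"
    using has_bochner_integral_gamma_density_powr[of m m "- 1 / 2"] m assms(4) by simp
  have gd_integrable: "integrable M (\<lambda>\<omega>. 1 / sqrt (gd \<omega>))"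
    using moment m distributed_integrable[OF gd, of "\<lambda>x. 1 / sqrt x"]
    by (simp add: gamma_density_nonneg has_bochner_integral_iff)
  have gd_expectation: "expectation (\<lambda>\<omega>. 1 / sqrt (gd \<omega>)) =
      Gamma (m - 1 / 2) / (Gamma m * m powr (- 1 / 2))"
    using moment m distributed_integral[OF gd, of "\<lambda>x. 1 / sqrt x"]
    by (simp add: gamma_density_nonneg has_bochner_integral_iff)

  have powr_integrable: "integrable lborel (\<lambda>x. gamma_density a m\<^sub>I x * x powr p)" if "p \<ge> 0" for p
    using has_bochner_integral_gamma_density_powr[of a m\<^sub>I p] a assms(5) that
    by (simp add: has_bochner_integral_iff)
  \<comment> \<open>For \<open>x > 0\<close>, \<open>sqrt (x + v) \<le> 1 + v + x\<close>, so the
    moments of order 0 and 1 dominate. Writing the bound with \<open>x powr 0\<close> and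
    \<open>x powr 1\<close> lets \<open>powr_integrable\<close> apply.\<close>
  have "integrable lborel (\<lambda>x. gamma_density a m\<^sub>I x * sqrt (x + v))"
  proof (rule Bochner_Integration.integrable_bound[OF _ _ AE_I2])
    show "integrable lborel (\<lambda>x. (1 + v) * (gamma_density a m\<^sub>I x * x powr 0) + gamma_density a m\<^sub>I x * x powr 1)"
      by (intro Bochner_Integration.integrable_add integrable_mult_right powr_integrable) auto
    show "norm (gamma_density a m\<^sub>I x * sqrt (x + v)) \<le>
        norm ((1 + v) * (gamma_density a m\<^sub>I x * x powr 0) + gamma_density a m\<^sub>I x * x powr 1)" for x
    proof (cases "x > 0")
      case True
      have "sqrt (x + v) \<le> 1 + v + x"
        using True v by (intro real_le_lsqrt) (auto simp: power2_eq_square algebra_simps)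
      from mult_left_mono[OF this gamma_density_nonneg[OF a]]
      have "gamma_density a m\<^sub>I x * sqrt (x + v) \<le>
          (1 + v) * (gamma_density a m\<^sub>I x * x powr 0) + gamma_density a m\<^sub>I x * x powr 1"
        using True by (simp add: algebra_simps)
      moreover have "gamma_density a m\<^sub>I x * sqrt (x + v) \<ge> 0"
        using True v gamma_density_nonneg[OF a] by simp
      ultimately show ?thesis
        by (simp only: real_norm_def)
    next
      case False
      then show ?thesis
        by (simp add: gamma_density_def)
    qed
  qed measurable
  then have S_integrable: "integrable M (\<lambda>\<omega>. sqrt (?S \<omega> + v))"
    using a distributed_integrable[OF S, of "\<lambda>x. sqrt (x + v)"]
    by (simp add: gamma_density_nonneg)
  have S_expectation: "expectation (\<lambda>\<omega>. sqrt (?S \<omega> + v)) =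
      sqrt v * (v * m\<^sub>I) powr a * tricomi_U a (3 / 2 + a) (v * m\<^sub>I)"
    using a v assms(5) distributed_integral[OF S, of "\<lambda>x. sqrt (x + v)"]
    by (simp add: gamma_density_nonneg gamma_density_integral_sqrt)

  \<comment> \<open>The root of the quotient splits at every sample point, with no sign condition,
    since \<open>sqrt\<close> is extended to negative reals as an odd function.\<close>
  have "EVM M L v gd g = expectation (\<lambda>\<omega>. 1 / sqrt (gd \<omega>) * sqrt (?S \<omega> + v))"
    by (simp add: EVM_def real_sqrt_divide)
  also have "\<dots> = expectation (\<lambda>\<omega>. 1 / sqrt (gd \<omega>)) * expectation (\<lambda>\<omega>. sqrt (?S \<omega> + v))"
    by (rule indep_var_lebesgue_integral[OF indep gd_integrable S_integrable])
  also have "\<dots> = (v * m\<^sub>I) powr a * tricomi_U a (3 / 2 + a) (v * m\<^sub>I) * Gamma (m - 1 / 2)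
      / (m powr (- 1 / 2) / sqrt v * Gamma m)"
    unfolding S_expectation gd_expectation by (simp add: mult_ac)
  \<comment> \<open>The factor \<open>sqrt v\<close> left over from the substitution joins the power
    of \<open>m\<close> in the denominator.\<close>
  also have "m powr (- 1 / 2) / sqrt v = (m * v) powr (- 1 / 2)"
    using v m by (simp add: powr_mult powr_minus_divide powr_half_sqrt)
  finally show ?thesis
    by (simp add: v_def a_def)
qed

end
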